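(* Let $R$ be a ring, let $M$ be a d-CS-Rickart right $R$-module and let $S=\mathrm{End}_R(M)$. Then the following statements hold: \begin{itemize} \item[(1)] If $A=eM$ and $B=fM$ for some $e^2=e\in S$ and $f^2=f\in S$, then there exists $g^2=g\in S$ such that $A+B$ lies above $gM$. \item[(2)] If $A,B$ are submodules of $M$ such that $A$ lies above $eM$ and $B$ lies above $fM$ for some $e^2=e\in S$ and $f^2=f\in S$, then there exists $g^2=g\in S$ such that $A+B$ lies above $gM$. \item[(3)] For arbitrary homomorphisms $\varphi_1,\ldots,\varphi_n\in S$, there exists an idempotent $e\in S$ such that $\sum_{i=1}^n\mathrm{Im}\,\varphi_i$ lies above $eM$. \item[(4)] $M$ is an SSP-d-CS module. \end{itemize}
   Context: All rings are associative with nonzero identity; modules are unitary right modules. A submodule $K$ of $L$ is small if $K+X=L$ implies $X=L$ for submodules $X$ of $L$. A submodule $N$ of a module $M$ lies above a direct summand $N_1$ of $M$ if there is a decomposition $M=N_1\oplus N_2$ such that $N_1\subset N$ and $N_2\cap N$ is small in $N_2$; $N$ lies above a direct summand of $M$ if it lies above some direct summand $N_1$ of $M$. A module $M$ is d-CS-Rickart if for every $\varphi\in\mathrm{End}_R(M)$, $\mathrm{Im}\,\varphi$ lies above a direct summand of $M$. A module $M$ is an SSP-d-CS module if the sum of any two direct summands of $M$ lies above a direct summand of $M$. *)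

theory Defs
  imports "HOL-Algebra.AbelCoset"
begin

text \<open>
  The modules of HOL-Algebra are modules over commutative rings, so unitary right modules over an
  arbitrary ring with nonzero identity are introduced here. The record reuses the additive part of
  the ring record, as HOL-Algebra does for its own modules.
\<close>

record ('a, 'b) rmodule = "'b ring" +
  rsmult :: "'b \<Rightarrow> 'a \<Rightarrow> 'b" (infixl \<open>\<bullet>\<index>\<close> 70)

locale right_module = R: ring R + M: abelian_group M
  for R :: "('a, 'c) ring_scheme" (structure) and M :: "('a, 'b, 'd) rmodule_scheme" (structure) +
  assumes one_not_zero: "\<one>\<^bsub>R\<^esub> \<noteq> \<zero>\<^bsub>R\<^esub>"
    and rsmult_closed [simp, intro]:
      "\<lbrakk>x \<in> carrier M; a \<in> carrier R\<rbrakk> \<Longrightarrow> x \<bullet>\<^bsub>M\<^esub> a \<in> carrier M"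
    and rsmult_r_distr:
      "\<lbrakk>x \<in> carrier M; a \<in> carrier R; b \<in> carrier R\<rbrakk>
        \<Longrightarrow> x \<bullet>\<^bsub>M\<^esub> (a \<oplus>\<^bsub>R\<^esub> b) = x \<bullet>\<^bsub>M\<^esub> a \<oplus>\<^bsub>M\<^esub> x \<bullet>\<^bsub>M\<^esub> b"
    and rsmult_l_distr:
      "\<lbrakk>x \<in> carrier M; y \<in> carrier M; a \<in> carrier R\<rbrakk>
        \<Longrightarrow> (x \<oplus>\<^bsub>M\<^esub> y) \<bullet>\<^bsub>M\<^esub> a = x \<bullet>\<^bsub>M\<^esub> a \<oplus>\<^bsub>M\<^esub> y \<bullet>\<^bsub>M\<^esub> a"
    and rsmult_assoc:
      "\<lbrakk>x \<in> carrier M; a \<in> carrier R; b \<in> carrier R\<rbrakk>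
        \<Longrightarrow> x \<bullet>\<^bsub>M\<^esub> (a \<otimes>\<^bsub>R\<^esub> b) = (x \<bullet>\<^bsub>M\<^esub> a) \<bullet>\<^bsub>M\<^esub> b"
    and rsmult_one [simp]: "x \<in> carrier M \<Longrightarrow> x \<bullet>\<^bsub>M\<^esub> \<one>\<^bsub>R\<^esub> = x"

definition rsubmodule :: "('a, 'c) ring_scheme \<Rightarrow> ('a, 'b, 'd) rmodule_scheme \<Rightarrow> 'b set \<Rightarrow> bool" where
  "rsubmodule R M N \<longleftrightarrow>
     subgroup N (add_monoid M) \<and> (\<forall>x\<in>N. \<forall>a\<in>carrier R. x \<bullet>\<^bsub>M\<^esub> a \<in> N)"

text \<open>
  Homomorphisms are extensional functions (undefined outside the carrier), so that equality in
  \<open>End_ring\<close> is equality of maps on the carrier.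
\<close>

definition rmodule_hom ::
    "('a, 'c) ring_scheme \<Rightarrow> ('a, 'b, 'd) rmodule_scheme \<Rightarrow> ('a, 'e, 'f) rmodule_scheme \<Rightarrow> ('b \<Rightarrow> 'e) set" where
  "rmodule_hom R M N =
     {h \<in> carrier M \<rightarrow>\<^sub>E carrier N.
        (\<forall>x\<in>carrier M. \<forall>y\<in>carrier M. h (x \<oplus>\<^bsub>M\<^esub> y) = h x \<oplus>\<^bsub>N\<^esub> h y) \<and>
        (\<forall>x\<in>carrier M. \<forall>a\<in>carrier R. h (x \<bullet>\<^bsub>M\<^esub> a) = h x \<bullet>\<^bsub>N\<^esub> a)}"

definition End_ring :: "('a, 'c) ring_scheme \<Rightarrow> ('a, 'b, 'd) rmodule_scheme \<Rightarrow> ('b \<Rightarrow> 'b) ring" where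
  "End_ring R M =
     \<lparr>carrier = rmodule_hom R M M,
      monoid.mult = (\<lambda>f g. compose (carrier M) f g),
      monoid.one = (\<lambda>x\<in>carrier M. x),
      ring.zero = (\<lambda>x\<in>carrier M. \<zero>\<^bsub>M\<^esub>),
      ring.add = (\<lambda>f g. \<lambda>x\<in>carrier M. f x \<oplus>\<^bsub>M\<^esub> g x)\<rparr>"

context right_module
begin

lemma zero_rsmult: assumes "a \<in> carrier R" shows "\<zero>\<^bsub>M\<^esub> \<bullet>\<^bsub>M\<^esub> a = \<zero>\<^bsub>M\<^esub>"
proof -
  have "\<zero>\<^bsub>M\<^esub> \<bullet>\<^bsub>M\<^esub> a \<oplus>\<^bsub>M\<^esub> \<zero>\<^bsub>M\<^esub> \<bullet>\<^bsub>M\<^esub> a = \<zero>\<^bsub>M\<^esub> \<bullet>\<^bsub>M\<^esub> a"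
    using assms rsmult_l_distr[of "\<zero>\<^bsub>M\<^esub>" "\<zero>\<^bsub>M\<^esub>" a] by simp
  then show ?thesis using assms by (metis M.add.r_cancel_one M.zero_closed rsmult_closed)
qed

lemma rmodule_hom_iff: "f \<in> rmodule_hom R M M \<longleftrightarrow> f \<in> extensional (carrier M) \<and> (\<forall>x\<in>carrier M. f x \<in> carrier M)
   \<and> (\<forall>x\<in>carrier M. \<forall>y\<in>carrier M. f (x \<oplus>\<^bsub>M\<^esub> y) = f x \<oplus>\<^bsub>M\<^esub> f y) \<and>
        (\<forall>x\<in>carrier M. \<forall>a\<in>carrier R. f (x \<bullet>\<^bsub>M\<^esub> a) = f x \<bullet>\<^bsub>M\<^esub> a)"
  by (auto simp: rmodule_hom_def PiE_iff)

lemma a_inv_rsmult: assumes "x \<in> carrier M" "a \<in> carrier R" shows "(\<ominus>\<^bsub>M\<^esub> x) \<bullet>\<^bsub>M\<^esub> a = \<ominus>\<^bsub>M\<^esub> (x \<bullet>\<^bsub>M\<^esub> a)"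
  using rsmult_l_distr[of "\<ominus>\<^bsub>M\<^esub> x" x a] zero_rsmult assms
  by (metis M.a_inv_closed M.l_neg M.minus_equality rsmult_closed)

lemma ring_End: "ring (End_ring R M)"
proof (rule ringI)
  show "abelian_group (End_ring R M)"
  proof (rule abelian_groupI)
    fix f assume f: "f \<in> carrier (End_ring R M)"
    let ?g = "\<lambda>x\<in>carrier M. \<ominus>\<^bsub>M\<^esub> f x"
    have "?g \<in> carrier (End_ring R M)" using f
      by (simp add: End_ring_def rmodule_hom_iff a_inv_rsmult M.minus_add)
    moreover have "?g \<oplus>\<^bsub>End_ring R M\<^esub> f = \<zero>\<^bsub>End_ring R M\<^esub>" using f
      by (auto simp add: End_ring_def rmodule_hom_iff M.l_neg intro!: restrict_ext)
    ultimately show "\<exists>y\<in>carrier (End_ring R M). y \<oplus>\<^bsub>End_ring R M\<^esub> f = \<zero>\<^bsub>End_ring R M\<^esub>" by blast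
  qed (auto simp: End_ring_def rmodule_hom_iff zero_rsmult rsmult_l_distr M.a_ac
      extensional_restrict intro!: restrict_ext extensionalityI[of _ "carrier M"])
  show "monoid (End_ring R M)"
    by (rule monoidI) (auto simp: End_ring_def rmodule_hom_iff compose_def extensional_restrict
          intro!: restrict_ext extensionalityI[of _ "carrier M"])
qed (auto simp: End_ring_def rmodule_hom_iff compose_def intro!: restrict_ext)

lemma right_module_rsubmodule: assumes "rsubmodule R M N" shows "right_module R (M\<lparr>carrier := N\<rparr>)"
proof -
  have s: "subgroup N (add_monoid M)" using assms by (simp add: rsubmodule_def)
  have sc: "N \<subseteq> carrier M" using s by (auto simp: subgroup_def)
  have g: "group (add_monoid (M\<lparr>carrier := N\<rparr>))"
    using M.add.subgroup_imp_group[OF s] by (simp)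
  have "abelian_group (M\<lparr>carrier := N\<rparr>)"
    using g sc by (intro abelian_group.intro abelian_monoid.intro abelian_group_axioms.intro
       comm_monoid.intro comm_group.intro comm_monoid_axioms.intro group.is_monoid)
      (auto intro!: M.a_comm)
  then show ?thesis using assms sc one_not_zero
    by (intro right_module.intro right_module_axioms.intro R.ring_axioms)
      (auto simp: rsubmodule_def subset_iff rsmult_r_distr rsmult_l_distr rsmult_assoc)
qed

end

definition internal_direct_sum ::
    "('a, 'c) ring_scheme \<Rightarrow> ('a, 'b, 'd) rmodule_scheme \<Rightarrow> 'b set \<Rightarrow> 'b set \<Rightarrow> bool" where
  "internal_direct_sum R M N\<^sub>1 N\<^sub>2 \<longleftrightarrow>
     rsubmodule R M N\<^sub>1 \<and> rsubmodule R M N\<^sub>2 \<and>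
     N\<^sub>1 <+>\<^bsub>M\<^esub> N\<^sub>2 = carrier M \<and> N\<^sub>1 \<inter> N\<^sub>2 = {\<zero>\<^bsub>M\<^esub>}"

definition direct_summand ::
    "('a, 'c) ring_scheme \<Rightarrow> ('a, 'b, 'd) rmodule_scheme \<Rightarrow> 'b set \<Rightarrow> bool" where
  "direct_summand R M N\<^sub>1 \<longleftrightarrow> (\<exists>N\<^sub>2. internal_direct_sum R M N\<^sub>1 N\<^sub>2)"

definition small_submodule ::
    "('a, 'c) ring_scheme \<Rightarrow> ('a, 'b, 'd) rmodule_scheme \<Rightarrow> 'b set \<Rightarrow> bool" where
  "small_submodule R L K \<longleftrightarrow>
     rsubmodule R L K \<and>
     (\<forall>Y. rsubmodule R L Y \<longrightarrow> K <+>\<^bsub>L\<^esub> Y = carrier L \<longrightarrow> Y = carrier L)"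

text \<open>
  Here \<open>M\<lparr>carrier := N\<^sub>2\<rparr>\<close> is the submodule \<open>N\<^sub>2\<close> regarded as a module in its own right.
\<close>

definition lies_above ::
    "('a, 'c) ring_scheme \<Rightarrow> ('a, 'b, 'd) rmodule_scheme \<Rightarrow> 'b set \<Rightarrow> 'b set \<Rightarrow> bool" where
  "lies_above R M N N\<^sub>1 \<longleftrightarrow>
     rsubmodule R M N \<and>
     (\<exists>N\<^sub>2. internal_direct_sum R M N\<^sub>1 N\<^sub>2 \<and> N\<^sub>1 \<subseteq> N \<and>
           small_submodule R (M\<lparr>carrier := N\<^sub>2\<rparr>) (N\<^sub>2 \<inter> N))"

definition lies_above_direct_summand ::
    "('a, 'c) ring_scheme \<Rightarrow> ('a, 'b, 'd) rmodule_scheme \<Rightarrow> 'b set \<Rightarrow> bool" where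
  "lies_above_direct_summand R M N \<longleftrightarrow>
     (\<exists>N\<^sub>1. direct_summand R M N\<^sub>1 \<and> lies_above R M N N\<^sub>1)"

definition d_CS_Rickart :: "('a, 'c) ring_scheme \<Rightarrow> ('a, 'b, 'd) rmodule_scheme \<Rightarrow> bool" where
  "d_CS_Rickart R M \<longleftrightarrow>
     (\<forall>\<phi>\<in>carrier (End_ring R M). lies_above_direct_summand R M (\<phi> ` carrier M))"

definition SSP_d_CS :: "('a, 'c) ring_scheme \<Rightarrow> ('a, 'b, 'd) rmodule_scheme \<Rightarrow> bool" where
  "SSP_d_CS R M \<longleftrightarrow>
     (\<forall>A B. direct_summand R M A \<longrightarrow> direct_summand R M B \<longrightarrow>
            lies_above_direct_summand R M (A <+>\<^bsub>M\<^esub> B))"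

definition sum_submodules :: "('b, 'd) ring_scheme \<Rightarrow> 'i set \<Rightarrow> ('i \<Rightarrow> 'b set) \<Rightarrow> 'b set" where
  "sum_submodules M I N = {\<Oplus>\<^bsub>M\<^esub>i\<in>I. x i | x. x \<in> (\<Pi> i\<in>I. N i)}"

end

theory Submission
  imports Defs
begin

text \<open>
  The central observation is that \<open>N\<close> lies above a direct summand \<open>X\<close> of \<open>M\<close> exactly when
  \<open>N = X + K\<close> for some \<open>K\<close> that is small in \<open>M\<close> itself (lemma \<open>lies_above_iff\<close>). This removes the
  complement of \<open>X\<close> from the definition. As sums of small submodules are small, adding
  submodules that lie above direct summands reduces to adding the direct summands.

  So let \<open>A\<close> and \<open>B\<close> be direct summands and let \<open>M = A \<oplus> C\<close>. By the modular law
  \<open>A + B = A + (C \<inter> (A + B))\<close>, and the second term is the image of the endomorphism that projects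
  \<open>M\<close> onto \<open>B\<close> and then onto \<open>C\<close> along \<open>A\<close>. The d-CS-Rickart property therefore writes it as
  \<open>X + K\<close> with \<open>X\<close> a direct summand and \<open>K\<close> small. Since \<open>X\<close> is contained in the complement \<open>C\<close>
  of \<open>A\<close>, the sum \<open>A + X\<close> is again a direct summand, and \<open>A + B = (A + X) + K\<close>. All steps other
  than the description of \<open>C \<inter> (A + B)\<close> as an image take place in the modular lattice of
  submodules. Direct summands and images of idempotent endomorphisms are the same thing, which
  gives the formulations with idempotents; finite sums follow by induction.
\<close>

section \<open>The modular lattice of submodules\<close>

context right_module
begin

lemma rsubmodule_iff:
  "rsubmodule R M N \<longleftrightarrow> N \<subseteq> carrier M \<and> \<zero>\<^bsub>M\<^esub> \<in> N \<and>
     (\<forall>x\<in>N. \<forall>y\<in>N. x \<oplus>\<^bsub>M\<^esub> y \<in> N) \<and> (\<forall>x\<in>N. \<ominus>\<^bsub>M\<^esub> x \<in> N) \<and>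
     (\<forall>x\<in>N. \<forall>a\<in>carrier R. x \<bullet>\<^bsub>M\<^esub> a \<in> N)"
  unfolding rsubmodule_def subgroup_def by (auto simp: a_inv_def)

lemma rsubmoduleD:
  assumes "rsubmodule R M N"
  shows "N \<subseteq> carrier M" "\<zero>\<^bsub>M\<^esub> \<in> N" "x \<in> N \<Longrightarrow> y \<in> N \<Longrightarrow> x \<oplus>\<^bsub>M\<^esub> y \<in> N"
    "x \<in> N \<Longrightarrow> \<ominus>\<^bsub>M\<^esub> x \<in> N" "x \<in> N \<Longrightarrow> a \<in> carrier R \<Longrightarrow> x \<bullet>\<^bsub>M\<^esub> a \<in> N"
    "x \<in> N \<Longrightarrow> x \<in> carrier M"
  using assms unfolding rsubmodule_iff by auto

lemma mem_set_add_iff: "x \<in> A <+>\<^bsub>M\<^esub> B \<longleftrightarrow> (\<exists>a\<in>A. \<exists>b\<in>B. x = a \<oplus>\<^bsub>M\<^esub> b)"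
  by (auto simp: set_add_def set_mult_def)

lemma set_add_memI: "a \<in> A \<Longrightarrow> b \<in> B \<Longrightarrow> a \<oplus>\<^bsub>M\<^esub> b \<in> A <+>\<^bsub>M\<^esub> B"
  by (auto simp: mem_set_add_iff)

lemma rsubmodule_carrier: "rsubmodule R M (carrier M)"
  unfolding rsubmodule_iff by auto

lemma rsubmodule_zero: "rsubmodule R M {\<zero>\<^bsub>M\<^esub>}"
  unfolding rsubmodule_iff by (auto simp: zero_rsmult)

lemma rsubmodule_Int:
  "rsubmodule R M A \<Longrightarrow> rsubmodule R M B \<Longrightarrow> rsubmodule R M (A \<inter> B)"
  unfolding rsubmodule_iff by auto

lemma rsubmodule_sum:
  assumes "rsubmodule R M A" "rsubmodule R M B"
  shows "rsubmodule R M (A <+>\<^bsub>M\<^esub> B)"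
  unfolding rsubmodule_iff
proof (intro conjI ballI)
  note A = rsubmoduleD[OF assms(1)] and B = rsubmoduleD[OF assms(2)]
  show "A <+>\<^bsub>M\<^esub> B \<subseteq> carrier M" using A(6) B(6) by (auto simp: mem_set_add_iff)
  show "\<zero>\<^bsub>M\<^esub> \<in> A <+>\<^bsub>M\<^esub> B" using A(2) B(2) by (force simp: mem_set_add_iff)
  fix x assume "x \<in> A <+>\<^bsub>M\<^esub> B"
  then obtain a b where x: "a \<in> A" "b \<in> B" "x = a \<oplus>\<^bsub>M\<^esub> b" by (auto simp: mem_set_add_iff)
  show "\<ominus>\<^bsub>M\<^esub> x \<in> A <+>\<^bsub>M\<^esub> B"
    using x(3) set_add_memI[OF A(4)[OF x(1)] B(4)[OF x(2)]] x A(6) B(6) by (simp add: M.minus_add)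
  show "x \<bullet>\<^bsub>M\<^esub> r \<in> A <+>\<^bsub>M\<^esub> B" if r: "r \<in> carrier R" for r
    using x(3) set_add_memI[OF A(5)[OF x(1) r] B(5)[OF x(2) r]] x A(6) B(6) r
    by (simp add: rsmult_l_distr)
  fix y assume "y \<in> A <+>\<^bsub>M\<^esub> B"
  then obtain c d where y: "c \<in> A" "d \<in> B" "y = c \<oplus>\<^bsub>M\<^esub> d" by (auto simp: mem_set_add_iff)
  have "x \<oplus>\<^bsub>M\<^esub> y = (a \<oplus>\<^bsub>M\<^esub> c) \<oplus>\<^bsub>M\<^esub> (b \<oplus>\<^bsub>M\<^esub> d)"
    using x y A(6) B(6) by (simp add: M.a_ac)
  then show "x \<oplus>\<^bsub>M\<^esub> y \<in> A <+>\<^bsub>M\<^esub> B"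
    using set_add_memI[OF A(3)[OF x(1) y(1)] B(3)[OF x(2) y(2)]] by simp
qed

lemma sum_assoc:
  assumes "rsubmodule R M A" "rsubmodule R M B" "rsubmodule R M C"
  shows "(A <+>\<^bsub>M\<^esub> B) <+>\<^bsub>M\<^esub> C = A <+>\<^bsub>M\<^esub> (B <+>\<^bsub>M\<^esub> C)"
  using assms[THEN rsubmoduleD(1)] M.add.set_mult_assoc[of A B C] by (simp add: set_add_def)

lemma sum_comm:
  assumes "rsubmodule R M A" "rsubmodule R M B"
  shows "A <+>\<^bsub>M\<^esub> B = B <+>\<^bsub>M\<^esub> A"
proof -
  have "U <+>\<^bsub>M\<^esub> V \<subseteq> V <+>\<^bsub>M\<^esub> U" if UV: "U \<subseteq> carrier M" "V \<subseteq> carrier M" for U V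
  proof
    fix x assume "x \<in> U <+>\<^bsub>M\<^esub> V"
    then obtain u v where x: "u \<in> U" "v \<in> V" "x = u \<oplus>\<^bsub>M\<^esub> v" by (auto simp: mem_set_add_iff)
    then have "x = v \<oplus>\<^bsub>M\<^esub> u" using UV M.a_comm[of u v] by blast
    then show "x \<in> V <+>\<^bsub>M\<^esub> U" using x set_add_memI by blast
  qed
  then show ?thesis using assms[THEN rsubmoduleD(1)] by blast
qed

lemma sum_upper1:
  assumes "rsubmodule R M A" "rsubmodule R M B"
  shows "A \<subseteq> A <+>\<^bsub>M\<^esub> B"
proof
  fix x assume "x \<in> A"
  then show "x \<in> A <+>\<^bsub>M\<^esub> B"
    using rsubmoduleD(6)[OF assms(1)] set_add_memI[OF _ rsubmoduleD(2)[OF assms(2)], of x] by simp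
qed

lemma sum_upper2:
  assumes "rsubmodule R M A" "rsubmodule R M B"
  shows "B \<subseteq> A <+>\<^bsub>M\<^esub> B"
  using sum_upper1[OF assms(2,1)] sum_comm[OF assms] by simp

lemma sum_least:
  assumes "rsubmodule R M C" "A \<subseteq> C" "B \<subseteq> C"
  shows "A <+>\<^bsub>M\<^esub> B \<subseteq> C"
  using assms(2,3) rsubmoduleD(3)[OF assms(1)] by (fastforce simp: mem_set_add_iff)

lemma sum_absorb:
  assumes "rsubmodule R M A" "rsubmodule R M B" "A \<subseteq> B"
  shows "A <+>\<^bsub>M\<^esub> B = B"
  using sum_least[OF assms(2,3)] sum_upper2[OF assms(1,2)] by blast

lemma modular_law:
  assumes "rsubmodule R M A" "rsubmodule R M B" "rsubmodule R M C" "A \<subseteq> C"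
  shows "C \<inter> (A <+>\<^bsub>M\<^esub> B) = A <+>\<^bsub>M\<^esub> (C \<inter> B)"
proof
  show "A <+>\<^bsub>M\<^esub> (C \<inter> B) \<subseteq> C \<inter> (A <+>\<^bsub>M\<^esub> B)"
    using assms(4) rsubmoduleD(3)[OF assms(3)] by (fastforce simp: mem_set_add_iff)
  show "C \<inter> (A <+>\<^bsub>M\<^esub> B) \<subseteq> A <+>\<^bsub>M\<^esub> (C \<inter> B)"
  proof
    fix x assume "x \<in> C \<inter> (A <+>\<^bsub>M\<^esub> B)"
    then obtain a b where x: "x \<in> C" "a \<in> A" "b \<in> B" "x = a \<oplus>\<^bsub>M\<^esub> b"
      by (auto simp: mem_set_add_iff)
    note C = rsubmoduleD[OF assms(3)]
    have "b = \<ominus>\<^bsub>M\<^esub> a \<oplus>\<^bsub>M\<^esub> x"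
      using x rsubmoduleD(6)[OF assms(1)] rsubmoduleD(6)[OF assms(2)] M.r_neg1 by simp
    then have "b \<in> C" using C(3)[OF C(4) x(1), of a] x(2) assms(4) by auto
    then show "x \<in> A <+>\<^bsub>M\<^esub> (C \<inter> B)" using x by (auto simp: mem_set_add_iff)
  qed
qed

text \<open>
  This is the form in which the modular law splits a submodule \<open>N\<close> along
  \<open>M = X + Y\<close> with \<open>X \<subseteq> N\<close>.
\<close>

lemma modular_law_complement:
  assumes "rsubmodule R M X" "rsubmodule R M Y" "X <+>\<^bsub>M\<^esub> Y = carrier M"
    and "rsubmodule R M N" "X \<subseteq> N"
  shows "N = X <+>\<^bsub>M\<^esub> (Y \<inter> N)"
proof -
  have "N = N \<inter> (X <+>\<^bsub>M\<^esub> Y)" using assms(3) rsubmoduleD(1)[OF assms(4)] by blast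
  also have "\<dots> = X <+>\<^bsub>M\<^esub> (Y \<inter> N)"
    using modular_law[OF assms(1,2,4,5)] by (simp add: Int_commute)
  finally show ?thesis .
qed

section \<open>Small submodules and lying above a direct summand\<close>

lemma small_submodule_sum:
  assumes "small_submodule R M K" "small_submodule R M L"
  shows "small_submodule R M (K <+>\<^bsub>M\<^esub> L)"
proof -
  have KL: "rsubmodule R M K" "rsubmodule R M L" using assms by (auto simp: small_submodule_def)
  have "Y = carrier M" if Y: "rsubmodule R M Y" "(K <+>\<^bsub>M\<^esub> L) <+>\<^bsub>M\<^esub> Y = carrier M" for Y
  proof -
    have "L <+>\<^bsub>M\<^esub> Y = carrier M"
      using assms(1) sum_assoc[OF KL Y(1)] rsubmodule_sum[OF KL(2) Y(1)] Y(2)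
      by (simp add: small_submodule_def)
    then show ?thesis using assms(2) Y(1) by (simp add: small_submodule_def)
  qed
  then show ?thesis using rsubmodule_sum[OF KL] by (simp add: small_submodule_def)
qed

lemma small_submodule_zero: "small_submodule R M {\<zero>\<^bsub>M\<^esub>}"
  using sum_absorb[OF rsubmodule_zero] rsubmodule_zero
  by (auto simp: small_submodule_def dest: rsubmoduleD(2))

lemma rsubmodule_of_submodule_iff:
  assumes "rsubmodule R M N"
  shows "rsubmodule R (M\<lparr>carrier := N\<rparr>) Y \<longleftrightarrow> rsubmodule R M Y \<and> Y \<subseteq> N"
proof -
  have N: "subgroup N (add_monoid M)" using assms by (simp add: rsubmodule_def)
  have eq: "add_monoid (M\<lparr>carrier := N\<rparr>) = (add_monoid M)\<lparr>carrier := N\<rparr>" by simp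
  have "subgroup Y (add_monoid (M\<lparr>carrier := N\<rparr>)) \<longleftrightarrow> subgroup Y (add_monoid M) \<and> Y \<subseteq> N"
    unfolding eq using M.add.incl_subgroup[OF N, of Y] M.add.subgroup_incl[OF _ N, of Y]
    using subgroup.subset[of Y "(add_monoid M)\<lparr>carrier := N\<rparr>"] by auto
  then show ?thesis by (auto simp: rsubmodule_def)
qed

text \<open>
  Smallness inside \<open>N\<close> is expressed through submodules of \<open>M\<close>, so that the modular law of \<open>M\<close>
  applies to it.
\<close>

lemma small_in_submodule_iff:
  assumes "rsubmodule R M N"
  shows "small_submodule R (M\<lparr>carrier := N\<rparr>) K \<longleftrightarrow>
    rsubmodule R M K \<and> K \<subseteq> N \<and>
    (\<forall>Y. rsubmodule R M Y \<longrightarrow> Y \<subseteq> N \<longrightarrow> K <+>\<^bsub>M\<^esub> Y = N \<longrightarrow> Y = N)"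
proof -
  have "A <+>\<^bsub>M\<lparr>carrier := N\<rparr>\<^esub> B = A <+>\<^bsub>M\<^esub> B" for A B
    by (simp add: set_add_def set_mult_def)
  then show ?thesis
    by (auto simp: small_submodule_def rsubmodule_of_submodule_iff[OF assms])
qed

text \<open>
  If \<open>K \<subseteq> N\<close> and \<open>K + Y = M\<close>, then \<open>K + (N \<inter> Y) = N\<close> by the modular law. Smallness in \<open>N\<close> then
  gives \<open>N \<subseteq> Y\<close>, hence \<open>K \<subseteq> Y\<close> and \<open>Y = M\<close>.
\<close>

lemma small_submodule_enlarge:
  assumes N: "rsubmodule R M N" and K: "small_submodule R (M\<lparr>carrier := N\<rparr>) K"
  shows "small_submodule R M K"
proof -
  have K': "rsubmodule R M K" "K \<subseteq> N" using K small_in_submodule_iff[OF N] by auto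
  have "Y = carrier M" if Y: "rsubmodule R M Y" "K <+>\<^bsub>M\<^esub> Y = carrier M" for Y
  proof -
    have "K <+>\<^bsub>M\<^esub> (N \<inter> Y) = N"
      using modular_law[OF K'(1) Y(1) N K'(2)] Y(2) rsubmoduleD(1)[OF N] by auto
    then have "N \<inter> Y = N"
      using K rsubmodule_Int[OF N Y(1)] by (simp add: small_in_submodule_iff[OF N])
    then have "K \<subseteq> Y" using K'(2) by blast
    then show ?thesis using sum_absorb[OF K'(1) Y(1)] Y(2) by simp
  qed
  then show ?thesis using K'(1) by (simp add: small_submodule_def)
qed

text \<open>
  If \<open>M = X \<oplus> Y\<close>, a small submodule \<open>K\<close> of \<open>M\<close> has small image under the projection to \<open>Y\<close> along
  \<open>X\<close>, and for \<open>N = X + K\<close> that image is \<open>Y \<inter> N\<close>; so any complement \<open>Y\<close> will serve. Conversely,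
  \<open>K = Y \<inter> N\<close> is a suitable choice.
\<close>

lemma lies_above_iff:
  "lies_above R M N X \<longleftrightarrow>
     direct_summand R M X \<and> (\<exists>K. small_submodule R M K \<and> N = X <+>\<^bsub>M\<^esub> K)"
proof
  assume "lies_above R M N X"
  then obtain Y where N: "rsubmodule R M N" "X \<subseteq> N" and XY: "internal_direct_sum R M X Y"
    and small: "small_submodule R (M\<lparr>carrier := Y\<rparr>) (Y \<inter> N)"
    unfolding lies_above_def by blast
  have sub: "rsubmodule R M X" "rsubmodule R M Y" and M: "X <+>\<^bsub>M\<^esub> Y = carrier M"
    using XY by (auto simp: internal_direct_sum_def)
  have "N = X <+>\<^bsub>M\<^esub> (Y \<inter> N)"
    by (rule modular_law_complement[OF sub M N])
  then show "direct_summand R M X \<and> (\<exists>K. small_submodule R M K \<and> N = X <+>\<^bsub>M\<^esub> K)"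
    using XY small_submodule_enlarge[OF sub(2) small] unfolding direct_summand_def by blast
next
  assume "direct_summand R M X \<and> (\<exists>K. small_submodule R M K \<and> N = X <+>\<^bsub>M\<^esub> K)"
  then obtain Y K where XY: "internal_direct_sum R M X Y" and K: "small_submodule R M K"
    and NK: "N = X <+>\<^bsub>M\<^esub> K"
    unfolding direct_summand_def by blast
  have sub: "rsubmodule R M X" "rsubmodule R M Y" and M: "X <+>\<^bsub>M\<^esub> Y = carrier M"
    and zero: "X \<inter> Y = {\<zero>\<^bsub>M\<^esub>}"
    using XY by (auto simp: internal_direct_sum_def)
  have subK: "rsubmodule R M K" using K by (simp add: small_submodule_def)
  have N: "rsubmodule R M N" "X \<subseteq> N"
    using rsubmodule_sum[OF sub(1) subK] sum_upper1[OF sub(1) subK] NK by auto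
  note P = rsubmodule_Int[OF sub(2) N(1)]
  have NP: "N = X <+>\<^bsub>M\<^esub> (Y \<inter> N)"
    by (rule modular_law_complement[OF sub M N])
  have "Z = Y" if Z: "rsubmodule R M Z" "Z \<subseteq> Y" "(Y \<inter> N) <+>\<^bsub>M\<^esub> Z = Y" for Z
  proof -
    note XZ = rsubmodule_sum[OF sub(1) Z(1)]
    have "carrier M = N <+>\<^bsub>M\<^esub> Z"
      using M Z(3) sum_assoc[OF sub(1) P Z(1)] NP by simp
    also have "\<dots> = K <+>\<^bsub>M\<^esub> (X <+>\<^bsub>M\<^esub> Z)"
      using NK sum_comm[OF sub(1) subK] sum_assoc[OF subK sub(1) Z(1)] by simp
    \<comment> \<open>Smallness of \<open>K\<close> in \<open>M\<close> removes it from the sum; intersecting with \<open>Y\<close> then removes \<open>X\<close>.\<close>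
    finally have "X <+>\<^bsub>M\<^esub> Z = carrier M" using K XZ by (simp add: small_submodule_def)
    then have "Y = Z <+>\<^bsub>M\<^esub> (Y \<inter> X)"
      using modular_law[OF Z(1) sub(1) sub(2) Z(2)] sum_comm[OF sub(1) Z(1)]
        rsubmoduleD(1)[OF sub(2)] by auto
    also have "\<dots> = Z"
      using zero sum_comm[OF Z(1) rsubmodule_zero] sum_absorb[OF rsubmodule_zero Z(1)]
        rsubmoduleD(2)[OF Z(1)] by (simp add: Int_commute)
    finally show ?thesis by simp
  qed
  then have "small_submodule R (M\<lparr>carrier := Y\<rparr>) (Y \<inter> N)"
    using P by (simp add: small_in_submodule_iff[OF sub(2)])
  then show "lies_above R M N X"
    using N XY unfolding lies_above_def by blast
qed

lemma direct_summand_imp_rsubmodule: "direct_summand R M X \<Longrightarrow> rsubmodule R M X"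
  by (auto simp: direct_summand_def internal_direct_sum_def)

text \<open>
  If \<open>M = A \<oplus> C = X \<oplus> Y\<close> with \<open>X \<subseteq> C\<close>, then \<open>C = X \<oplus> (C \<inter> Y)\<close>, and so \<open>C \<inter> Y\<close> is a complement
  of \<open>A + X\<close>.
\<close>

lemma direct_summand_sum_in_complement:
  assumes AC: "internal_direct_sum R M A C" and X: "direct_summand R M X" "X \<subseteq> C"
  shows "direct_summand R M (A <+>\<^bsub>M\<^esub> X)"
proof -
  obtain Y where XY: "internal_direct_sum R M X Y" using X(1) by (auto simp: direct_summand_def)
  have sub: "rsubmodule R M A" "rsubmodule R M C" "rsubmodule R M X" "rsubmodule R M Y"
    and eq: "A <+>\<^bsub>M\<^esub> C = carrier M" "A \<inter> C = {\<zero>\<^bsub>M\<^esub>}"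
      "X <+>\<^bsub>M\<^esub> Y = carrier M" "X \<inter> Y = {\<zero>\<^bsub>M\<^esub>}"
    using AC XY by (auto simp: internal_direct_sum_def)
  note CY = rsubmodule_Int[OF sub(2,4)]
  have "C = X <+>\<^bsub>M\<^esub> (C \<inter> Y)"
    using modular_law[OF sub(3,4,2) X(2)] eq(3) rsubmoduleD(1)[OF sub(2)] by auto
  then have sum: "(A <+>\<^bsub>M\<^esub> X) <+>\<^bsub>M\<^esub> (C \<inter> Y) = carrier M"
    using sum_assoc[OF sub(1,3) CY] eq(1) by simp
  have "C \<inter> (A <+>\<^bsub>M\<^esub> X) = X <+>\<^bsub>M\<^esub> (C \<inter> A)"
    using modular_law[OF sub(3,1,2) X(2)] sum_comm[OF sub(1,3)] by simp
  also have "\<dots> = X"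
    using eq(2) sum_comm[OF sub(3) rsubmodule_zero] sum_absorb[OF rsubmodule_zero sub(3)]
      rsubmoduleD(2)[OF sub(3)] by (simp add: Int_commute)
  finally have "(A <+>\<^bsub>M\<^esub> X) \<inter> (C \<inter> Y) = {\<zero>\<^bsub>M\<^esub>}" using eq(4) by blast
  then show ?thesis
    using sum rsubmodule_sum[OF sub(1,3)] CY
    by (auto simp: direct_summand_def internal_direct_sum_def)
qed

section \<open>Direct summands as images of idempotent endomorphisms\<close>

lemma carrier_End_iff: "h \<in> carrier (End_ring R M) \<longleftrightarrow> h \<in> rmodule_hom R M M"
  by (simp add: End_ring_def)

lemma End_ringD:
  assumes "h \<in> carrier (End_ring R M)"
  shows "x \<in> carrier M \<Longrightarrow> h x \<in> carrier M"
    "x \<in> carrier M \<Longrightarrow> y \<in> carrier M \<Longrightarrow> h (x \<oplus>\<^bsub>M\<^esub> y) = h x \<oplus>\<^bsub>M\<^esub> h y"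
    "x \<in> carrier M \<Longrightarrow> a \<in> carrier R \<Longrightarrow> h (x \<bullet>\<^bsub>M\<^esub> a) = h x \<bullet>\<^bsub>M\<^esub> a"
    "h \<in> extensional (carrier M)"
  using assms by (auto simp: carrier_End_iff rmodule_hom_iff)

lemma mult_End_apply: "x \<in> carrier M \<Longrightarrow> (g \<otimes>\<^bsub>End_ring R M\<^esub> h) x = g (h x)"
  by (simp add: End_ring_def compose_def)

lemma End_ring_zero_minus:
  assumes "h \<in> carrier (End_ring R M)"
  shows "h \<zero>\<^bsub>M\<^esub> = \<zero>\<^bsub>M\<^esub>" "x \<in> carrier M \<Longrightarrow> h (\<ominus>\<^bsub>M\<^esub> x) = \<ominus>\<^bsub>M\<^esub> h x"
proof -
  note h = End_ringD[OF assms]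
  have "h \<zero>\<^bsub>M\<^esub> \<oplus>\<^bsub>M\<^esub> h \<zero>\<^bsub>M\<^esub> = h \<zero>\<^bsub>M\<^esub>" using h(2)[of "\<zero>\<^bsub>M\<^esub>" "\<zero>\<^bsub>M\<^esub>"] by simp
  then show zero: "h \<zero>\<^bsub>M\<^esub> = \<zero>\<^bsub>M\<^esub>" by (metis M.add.r_cancel_one M.zero_closed h(1))
  assume x: "x \<in> carrier M"
  then have "h (\<ominus>\<^bsub>M\<^esub> x) \<oplus>\<^bsub>M\<^esub> h x = \<zero>\<^bsub>M\<^esub>" using h(2)[of "\<ominus>\<^bsub>M\<^esub> x" x] zero by (simp add: M.l_neg)
  then show "h (\<ominus>\<^bsub>M\<^esub> x) = \<ominus>\<^bsub>M\<^esub> h x" using h(1) x M.minus_equality by simp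
qed

lemma image_rsubmodule:
  assumes "h \<in> carrier (End_ring R M)"
  shows "rsubmodule R M (h ` carrier M)"
proof -
  note h = End_ringD[OF assms] and h0 = End_ring_zero_minus[OF assms]
  show ?thesis unfolding rsubmodule_iff
  proof (intro conjI ballI)
    show "h ` carrier M \<subseteq> carrier M" using h(1) by blast
    show "\<zero>\<^bsub>M\<^esub> \<in> h ` carrier M" by (rule image_eqI[where x = "\<zero>\<^bsub>M\<^esub>"]) (simp_all add: h0(1))
  next
    fix y assume "y \<in> h ` carrier M"
    then obtain x where x: "x \<in> carrier M" "y = h x" by blast
    show "\<ominus>\<^bsub>M\<^esub> y \<in> h ` carrier M"
      unfolding x(2) by (rule image_eqI, rule h0(2)[OF x(1), symmetric]) (use x(1) in simp)
    show "y \<bullet>\<^bsub>M\<^esub> a \<in> h ` carrier M" if a: "a \<in> carrier R" for a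
      unfolding x(2) by (rule image_eqI, rule h(3)[OF x(1) a, symmetric]) (use x(1) a in simp)
    fix z assume "z \<in> h ` carrier M"
    then obtain w where w: "w \<in> carrier M" "z = h w" by blast
    show "y \<oplus>\<^bsub>M\<^esub> z \<in> h ` carrier M"
      unfolding x(2) w(2)
      by (rule image_eqI, rule h(2)[OF x(1) w(1), symmetric]) (use x(1) w(1) in simp)
  qed
qed

lemma kernel_rsubmodule:
  assumes "h \<in> carrier (End_ring R M)"
  shows "rsubmodule R M {x \<in> carrier M. h x = \<zero>\<^bsub>M\<^esub>}"
  unfolding rsubmodule_iff
  using End_ringD[OF assms] End_ring_zero_minus[OF assms] by (auto simp: zero_rsmult)

text \<open>
  The kernel is a complement of the image: \<open>x = e x + (x - e x)\<close>.
\<close>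

lemma idempotent_image_direct_summand:
  assumes e: "e \<in> carrier (End_ring R M)" "e \<otimes>\<^bsub>End_ring R M\<^esub> e = e"
  shows "direct_summand R M (e ` carrier M)"
proof -
  let ?K = "{x \<in> carrier M. e x = \<zero>\<^bsub>M\<^esub>}"
  note E = End_ringD[OF e(1)] and E0 = End_ring_zero_minus[OF e(1)]
  have idem: "e (e x) = e x" if "x \<in> carrier M" for x
    using mult_End_apply[OF that, of e e] e(2) by simp
  note I = image_rsubmodule[OF e(1)] and K = kernel_rsubmodule[OF e(1)]
  have "carrier M \<subseteq> e ` carrier M <+>\<^bsub>M\<^esub> ?K"
  proof
    fix x assume x: "x \<in> carrier M"
    have "x = e x \<oplus>\<^bsub>M\<^esub> (\<ominus>\<^bsub>M\<^esub> e x \<oplus>\<^bsub>M\<^esub> x)" using x E(1) by (simp add: M.r_neg2)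
    moreover have "\<ominus>\<^bsub>M\<^esub> e x \<oplus>\<^bsub>M\<^esub> x \<in> ?K" using x E(1,2) E0(2) idem by (simp add: M.l_neg)
    ultimately show "x \<in> e ` carrier M <+>\<^bsub>M\<^esub> ?K" using x unfolding mem_set_add_iff by blast
  qed
  then have "e ` carrier M <+>\<^bsub>M\<^esub> ?K = carrier M"
    using rsubmoduleD(1)[OF rsubmodule_sum[OF I K]] by blast
  moreover have "e ` carrier M \<inter> ?K = {\<zero>\<^bsub>M\<^esub>}"
    using idem rsubmoduleD(2)[OF I] E0(1) by auto
  ultimately show ?thesis using I K by (auto simp: direct_summand_def internal_direct_sum_def)
qed

lemma direct_sum_component_unique:
  assumes AB: "internal_direct_sum R M A B"
    and "a \<in> A" "a' \<in> A" "b \<in> B" "b' \<in> B" "a \<oplus>\<^bsub>M\<^esub> b = a' \<oplus>\<^bsub>M\<^esub> b'"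
  shows "a = a'"
proof -
  have sub: "rsubmodule R M A" "rsubmodule R M B" and zero: "A \<inter> B = {\<zero>\<^bsub>M\<^esub>}"
    using AB by (auto simp: internal_direct_sum_def)
  note A = rsubmoduleD[OF sub(1)] and B = rsubmoduleD[OF sub(2)]
  note c = assms(2,3)[THEN A(6)] assms(4,5)[THEN B(6)]
  have "\<ominus>\<^bsub>M\<^esub> a' \<oplus>\<^bsub>M\<^esub> a = (\<ominus>\<^bsub>M\<^esub> a' \<oplus>\<^bsub>M\<^esub> (a \<oplus>\<^bsub>M\<^esub> b)) \<oplus>\<^bsub>M\<^esub> \<ominus>\<^bsub>M\<^esub> b"
    using c by (simp add: M.a_assoc M.r_neg)
  also have "\<dots> = b' \<oplus>\<^bsub>M\<^esub> \<ominus>\<^bsub>M\<^esub> b" using c assms(6) by (simp add: M.r_neg1)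
  \<comment> \<open>The difference \<open>a - a' = b' - b\<close> lies in both summands.\<close>
  finally have "\<ominus>\<^bsub>M\<^esub> a' \<oplus>\<^bsub>M\<^esub> a \<in> B" using assms B(3,4) by simp
  moreover have "\<ominus>\<^bsub>M\<^esub> a' \<oplus>\<^bsub>M\<^esub> a \<in> A" using assms A(3,4) by simp
  ultimately have "\<ominus>\<^bsub>M\<^esub> a' \<oplus>\<^bsub>M\<^esub> a \<in> A \<inter> B" by simp
  then have "\<ominus>\<^bsub>M\<^esub> a' \<oplus>\<^bsub>M\<^esub> a = \<zero>\<^bsub>M\<^esub>" using zero by blast
  then have "a' = a' \<oplus>\<^bsub>M\<^esub> (\<ominus>\<^bsub>M\<^esub> a' \<oplus>\<^bsub>M\<^esub> a)" using c by simp
  then show ?thesis using c by (simp add: M.r_neg2)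
qed

lemma projection_exists:
  assumes AB: "internal_direct_sum R M A B"
  shows "\<exists>p\<in>carrier (End_ring R M). p ` carrier M = A \<and>
           (\<forall>a\<in>A. p a = a) \<and> (\<forall>b\<in>B. p b = \<zero>\<^bsub>M\<^esub>)"
proof -
  have sub: "rsubmodule R M A" "rsubmodule R M B" and sum: "A <+>\<^bsub>M\<^esub> B = carrier M"
    using AB by (auto simp: internal_direct_sum_def)
  note A = rsubmoduleD[OF sub(1)] and B = rsubmoduleD[OF sub(2)]
  have "\<forall>x\<in>carrier M. \<exists>a b. a \<in> A \<and> b \<in> B \<and> x = a \<oplus>\<^bsub>M\<^esub> b"
    using sum mem_set_add_iff by blast
  then obtain p q where pq: "p x \<in> A" "q x \<in> B" "x = p x \<oplus>\<^bsub>M\<^esub> q x" if "x \<in> carrier M" for x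
    by metis
  have p_sum: "p (a \<oplus>\<^bsub>M\<^esub> b) = a" if "a \<in> A" "b \<in> B" for a b
    using direct_sum_component_unique[OF AB] that pq[of "a \<oplus>\<^bsub>M\<^esub> b"] A(6) B(6)
    by (metis M.add.m_closed)
  have p_A: "p a = a" if "a \<in> A" for a
    using p_sum[OF that B(2)] A(6)[OF that] by simp
  have p_B: "p b = \<zero>\<^bsub>M\<^esub>" if "b \<in> B" for b
    using p_sum[OF A(2) that] B(6)[OF that] by simp
  have "p (x \<oplus>\<^bsub>M\<^esub> y) = p x \<oplus>\<^bsub>M\<^esub> p y" if x: "x \<in> carrier M" and y: "y \<in> carrier M" for x y
  proof -
    have "x \<oplus>\<^bsub>M\<^esub> y = (p x \<oplus>\<^bsub>M\<^esub> q x) \<oplus>\<^bsub>M\<^esub> (p y \<oplus>\<^bsub>M\<^esub> q y)" using pq(3)[OF x] pq(3)[OF y] by simp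
    also have "\<dots> = (p x \<oplus>\<^bsub>M\<^esub> p y) \<oplus>\<^bsub>M\<^esub> (q x \<oplus>\<^bsub>M\<^esub> q y)"
      using pq(1,2)[OF x] pq(1,2)[OF y] A(6) B(6) by (simp add: M.a_ac)
    finally show ?thesis
      using p_sum[OF A(3)[OF pq(1)[OF x] pq(1)[OF y]] B(3)[OF pq(2)[OF x] pq(2)[OF y]]] by simp
  qed
  moreover have "p (x \<bullet>\<^bsub>M\<^esub> r) = p x \<bullet>\<^bsub>M\<^esub> r" if x: "x \<in> carrier M" and r: "r \<in> carrier R" for x r
  proof -
    have "x \<bullet>\<^bsub>M\<^esub> r = (p x \<oplus>\<^bsub>M\<^esub> q x) \<bullet>\<^bsub>M\<^esub> r" using pq(3)[OF x] by simp
    also have "\<dots> = p x \<bullet>\<^bsub>M\<^esub> r \<oplus>\<^bsub>M\<^esub> q x \<bullet>\<^bsub>M\<^esub> r"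
      using pq(1,2)[OF x] A(6) B(6) r by (simp add: rsmult_l_distr)
    finally show ?thesis
      using p_sum[OF A(5)[OF pq(1)[OF x] r] B(5)[OF pq(2)[OF x] r]] by simp
  qed
  ultimately have "restrict p (carrier M) \<in> carrier (End_ring R M)"
    using pq(1) A(6) by (simp add: carrier_End_iff rmodule_hom_iff)
  moreover have "restrict p (carrier M) ` carrier M = A"
    using pq(1) p_A A(6) by (force simp: image_iff)
  ultimately show ?thesis
    using p_A p_B A(6) B(6) by (intro bexI[of _ "restrict p (carrier M)"]) auto
qed

lemma direct_summand_iff_idempotent_image:
  "direct_summand R M X \<longleftrightarrow>
     (\<exists>g\<in>carrier (End_ring R M). g \<otimes>\<^bsub>End_ring R M\<^esub> g = g \<and> X = g ` carrier M)"
proof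
  assume "direct_summand R M X"
  then obtain p where p: "p \<in> carrier (End_ring R M)" "p ` carrier M = X" "\<forall>a\<in>X. p a = a"
    using projection_exists unfolding direct_summand_def by blast
  have "p \<otimes>\<^bsub>End_ring R M\<^esub> p = p"
  proof (rule extensionalityI[of _ "carrier M"])
    show "p \<otimes>\<^bsub>End_ring R M\<^esub> p \<in> extensional (carrier M)" by (simp add: End_ring_def)
    show "p \<in> extensional (carrier M)" by (rule End_ringD(4)[OF p(1)])
  qed (use p in \<open>auto simp: mult_End_apply\<close>)
  then show "\<exists>g\<in>carrier (End_ring R M). g \<otimes>\<^bsub>End_ring R M\<^esub> g = g \<and> X = g ` carrier M"
    using p by blast
qed (use idempotent_image_direct_summand in blast)

lemma lies_above_direct_summand_iff_idempotent:
  "lies_above_direct_summand R M N \<longleftrightarrow>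
     (\<exists>g\<in>carrier (End_ring R M). g \<otimes>\<^bsub>End_ring R M\<^esub> g = g \<and> lies_above R M N (g ` carrier M))"
  unfolding lies_above_direct_summand_def direct_summand_iff_idempotent_image by blast

section \<open>Sums in d-CS-Rickart modules\<close>

text \<open>
  On the complement \<open>C\<close> the projection along \<open>A\<close> is the identity, so it sends an element \<open>a + b\<close>
  of \<open>C \<inter> (A + B)\<close> both to itself and to the image of \<open>b\<close>.
\<close>

lemma complement_Int_sum_is_image:
  assumes AC: "internal_direct_sum R M A C" and B: "direct_summand R M B"
  shows "\<exists>\<phi>\<in>carrier (End_ring R M). \<phi> ` carrier M = C \<inter> (A <+>\<^bsub>M\<^esub> B)"
proof -
  interpret E: ring "End_ring R M" by (rule ring_End)
  have sub: "rsubmodule R M A" "rsubmodule R M C" "rsubmodule R M B"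
    and CA: "internal_direct_sum R M C A"
    using AC direct_summand_imp_rsubmodule[OF B] sum_comm
    by (auto simp: internal_direct_sum_def Int_commute)
  note As = rsubmoduleD[OF sub(1)] and Cs = rsubmoduleD[OF sub(2)] and Bs = rsubmoduleD[OF sub(3)]
  obtain p where p: "p \<in> carrier (End_ring R M)" "p ` carrier M = C" "\<And>c. c \<in> C \<Longrightarrow> p c = c"
      "\<And>a. a \<in> A \<Longrightarrow> p a = \<zero>\<^bsub>M\<^esub>"
    using projection_exists[OF CA] by blast
  obtain q where q: "q \<in> carrier (End_ring R M)" "q ` carrier M = B"
    using B projection_exists unfolding direct_summand_def by blast
  \<comment> \<open>Project to \<open>B\<close> by \<open>q\<close>, then to \<open>C\<close> along \<open>A\<close> by \<open>p\<close>.\<close>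
  have "(p \<otimes>\<^bsub>End_ring R M\<^esub> q) ` carrier M = p ` B"
    unfolding q(2)[symmetric] image_image by (intro image_cong) (simp_all add: mult_End_apply)
  also have "\<dots> = C \<inter> (A <+>\<^bsub>M\<^esub> B)"
  proof (intro equalityI subsetI)
    fix x assume "x \<in> p ` B"
    then obtain b where b: "b \<in> B" "x = p b" by blast
    have "b \<in> A <+>\<^bsub>M\<^esub> C" using AC Bs(6)[OF b(1)] by (simp add: internal_direct_sum_def)
    then obtain a c where ac: "a \<in> A" "c \<in> C" "b = a \<oplus>\<^bsub>M\<^esub> c" by (auto simp: mem_set_add_iff)
    have "x = c" using b(2) ac p(3,4) As(6) Cs(6) End_ringD(2)[OF p(1)] by simp
    moreover have "c = \<ominus>\<^bsub>M\<^esub> a \<oplus>\<^bsub>M\<^esub> b" using ac As(6) Cs(6) M.r_neg1 by simp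
    ultimately show "x \<in> C \<inter> (A <+>\<^bsub>M\<^esub> B)" using ac(2) set_add_memI[OF As(4)[OF ac(1)] b(1)] by simp
  next
    fix x assume "x \<in> C \<inter> (A <+>\<^bsub>M\<^esub> B)"
    then obtain a b where x: "x \<in> C" "a \<in> A" "b \<in> B" "x = a \<oplus>\<^bsub>M\<^esub> b"
      by (auto simp: mem_set_add_iff)
    have "x = p (a \<oplus>\<^bsub>M\<^esub> b)" using p(3)[OF x(1)] x(4) by simp
    also have "\<dots> = p b" using x p(4) As(6) Bs(6) End_ringD(1,2)[OF p(1)] by simp
    finally show "x \<in> p ` B" using x(3) by blast
  qed
  finally show ?thesis using E.m_closed[OF p(1) q(1)] by blast
qed

lemma lies_above_direct_summand_iff:
  "lies_above_direct_summand R M N \<longleftrightarrow>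
     (\<exists>X K. direct_summand R M X \<and> small_submodule R M K \<and> N = X <+>\<^bsub>M\<^esub> K)"
  unfolding lies_above_direct_summand_def lies_above_iff by blast

text \<open>
  The endomorphism to which the d-CS-Rickart property is applied is the composite of two
  projections, with image \<open>C \<inter> (A + B)\<close> for a complement \<open>C\<close> of \<open>A\<close>.
\<close>

lemma d_CS_Rickart_sum_of_direct_summands:
  assumes dCS: "d_CS_Rickart R M" and A: "direct_summand R M A" and B: "direct_summand R M B"
  shows "lies_above_direct_summand R M (A <+>\<^bsub>M\<^esub> B)"
proof -
  obtain C where AC: "internal_direct_sum R M A C" using A by (auto simp: direct_summand_def)
  have sub: "rsubmodule R M A" "rsubmodule R M C" "rsubmodule R M B" and M: "A <+>\<^bsub>M\<^esub> C = carrier M"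
    using AC direct_summand_imp_rsubmodule[OF B] by (auto simp: internal_direct_sum_def)
  note AB = rsubmodule_sum[OF sub(1,3)]
  have "lies_above_direct_summand R M (C \<inter> (A <+>\<^bsub>M\<^esub> B))"
    using complement_Int_sum_is_image[OF AC B] dCS unfolding d_CS_Rickart_def by metis
  then obtain X K where X: "direct_summand R M X" and K: "small_submodule R M K"
    and XK: "C \<inter> (A <+>\<^bsub>M\<^esub> B) = X <+>\<^bsub>M\<^esub> K"
    using lies_above_direct_summand_iff by blast
  have subs: "rsubmodule R M X" "rsubmodule R M K"
    using direct_summand_imp_rsubmodule[OF X] K by (auto simp: small_submodule_def)
  have "X \<subseteq> C" using XK sum_upper1[OF subs] by blast
  then have AX: "direct_summand R M (A <+>\<^bsub>M\<^esub> X)"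
    by (rule direct_summand_sum_in_complement[OF AC X])
  have "A <+>\<^bsub>M\<^esub> B = A <+>\<^bsub>M\<^esub> (C \<inter> (A <+>\<^bsub>M\<^esub> B))"
    by (rule modular_law_complement[OF sub(1,2) M AB sum_upper1[OF sub(1,3)]])
  also have "\<dots> = (A <+>\<^bsub>M\<^esub> X) <+>\<^bsub>M\<^esub> K" using XK sum_assoc[OF sub(1) subs] by simp
  finally show ?thesis using AX K lies_above_direct_summand_iff by blast
qed

text \<open>
  With \<open>A = X + K\<close> and \<open>B = Y + L\<close>, the sum of direct summands \<open>X + Y\<close> is \<open>Z + P\<close>, so
  \<open>A + B = Z + (P + K + L)\<close> with \<open>P + K + L\<close> small.
\<close>

lemma d_CS_Rickart_sum_lies_above:
  assumes dCS: "d_CS_Rickart R M"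
    and A: "lies_above_direct_summand R M A" and B: "lies_above_direct_summand R M B"
  shows "lies_above_direct_summand R M (A <+>\<^bsub>M\<^esub> B)"
proof -
  obtain X K where XK: "direct_summand R M X" "small_submodule R M K" "A = X <+>\<^bsub>M\<^esub> K"
    using A lies_above_direct_summand_iff by blast
  obtain Y L where YL: "direct_summand R M Y" "small_submodule R M L" "B = Y <+>\<^bsub>M\<^esub> L"
    using B lies_above_direct_summand_iff by blast
  obtain Z P where ZP: "direct_summand R M Z" "small_submodule R M P" "X <+>\<^bsub>M\<^esub> Y = Z <+>\<^bsub>M\<^esub> P"
    using d_CS_Rickart_sum_of_direct_summands[OF dCS XK(1) YL(1)] lies_above_direct_summand_iff
    by blast
  have sub: "rsubmodule R M X" "rsubmodule R M Y" "rsubmodule R M Z"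
      "rsubmodule R M K" "rsubmodule R M L" "rsubmodule R M P"
    using XK YL ZP direct_summand_imp_rsubmodule by (auto simp: small_submodule_def)
  note [simp] = sub rsubmodule_sum
  have "A <+>\<^bsub>M\<^esub> B = X <+>\<^bsub>M\<^esub> ((K <+>\<^bsub>M\<^esub> Y) <+>\<^bsub>M\<^esub> L)" using XK YL by (simp add: sum_assoc)
  also have "K <+>\<^bsub>M\<^esub> Y = Y <+>\<^bsub>M\<^esub> K" by (simp add: sum_comm)
  also have "X <+>\<^bsub>M\<^esub> ((Y <+>\<^bsub>M\<^esub> K) <+>\<^bsub>M\<^esub> L) = (X <+>\<^bsub>M\<^esub> Y) <+>\<^bsub>M\<^esub> (K <+>\<^bsub>M\<^esub> L)" by (simp add: sum_assoc)
  also have "\<dots> = Z <+>\<^bsub>M\<^esub> (P <+>\<^bsub>M\<^esub> (K <+>\<^bsub>M\<^esub> L))" by (simp add: ZP(3) sum_assoc)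
  finally show ?thesis
    using ZP(1) small_submodule_sum[OF ZP(2) small_submodule_sum[OF XK(2) YL(2)]]
      lies_above_direct_summand_iff by blast
qed

lemma mem_sum_submodules_iff:
  "z \<in> sum_submodules M I N \<longleftrightarrow> (\<exists>x. z = (\<Oplus>\<^bsub>M\<^esub>i\<in>I. x i) \<and> x \<in> (\<Pi> i\<in>I. N i))"
  by (simp only: sum_submodules_def mem_Collect_eq)

lemma sum_submodules_empty: "sum_submodules M {} N = {\<zero>\<^bsub>M\<^esub>}"
  by (simp add: sum_submodules_def)

lemma sum_submodules_insert:
  assumes "finite I" "i \<notin> I" "\<And>j. j \<in> insert i I \<Longrightarrow> N j \<subseteq> carrier M"
  shows "sum_submodules M (insert i I) N = N i <+>\<^bsub>M\<^esub> sum_submodules M I N"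
proof (intro equalityI subsetI)
  fix z assume "z \<in> sum_submodules M (insert i I) N"
  then obtain x where x: "x \<in> (\<Pi> j\<in>insert i I. N j)" "z = (\<Oplus>\<^bsub>M\<^esub>j\<in>insert i I. x j)"
    unfolding mem_sum_submodules_iff by (elim exE conjE) (rule that)
  have sum: "z = x i \<oplus>\<^bsub>M\<^esub> (\<Oplus>\<^bsub>M\<^esub>j\<in>I. x j)"
    unfolding x(2)
  proof (rule M.finsum_insert[OF assms(1,2)])
    show "x \<in> I \<rightarrow> carrier M" using Pi_mem[OF x(1)] assms(3) by blast
    show "x i \<in> carrier M" using Pi_mem[OF x(1), of i] assms(3)[of i] by blast
  qed
  show "z \<in> N i <+>\<^bsub>M\<^esub> sum_submodules M I N"
  proof (subst sum, intro set_add_memI)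
    show "x i \<in> N i" using Pi_mem[OF x(1)] by simp
    have "x \<in> (\<Pi> j\<in>I. N j)" using Pi_mem[OF x(1)] by simp
    then show "(\<Oplus>\<^bsub>M\<^esub>j\<in>I. x j) \<in> sum_submodules M I N"
      unfolding mem_sum_submodules_iff by (intro exI[of _ x] conjI refl)
  qed
next
  fix z assume "z \<in> N i <+>\<^bsub>M\<^esub> sum_submodules M I N"
  then obtain y w where w: "y \<in> N i" "w \<in> sum_submodules M I N" "z = y \<oplus>\<^bsub>M\<^esub> w"
    unfolding mem_set_add_iff by blast
  obtain x where "w = (\<Oplus>\<^bsub>M\<^esub>j\<in>I. x j)" "x \<in> (\<Pi> j\<in>I. N j)"
    using w(2) unfolding mem_sum_submodules_iff by (elim exE conjE) (rule that)
  with w have x: "y \<in> N i" "x \<in> (\<Pi> j\<in>I. N j)" "z = y \<oplus>\<^bsub>M\<^esub> (\<Oplus>\<^bsub>M\<^esub>j\<in>I. x j)" by simp_all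
  let ?x = "x(i := y)"
  have mem: "?x \<in> (\<Pi> j\<in>insert i I. N j)" using x by auto
  then have "(\<Oplus>\<^bsub>M\<^esub>j\<in>insert i I. ?x j) = ?x i \<oplus>\<^bsub>M\<^esub> (\<Oplus>\<^bsub>M\<^esub>j\<in>I. ?x j)"
  proof (intro M.finsum_insert[OF assms(1,2)])
    show "?x \<in> I \<rightarrow> carrier M" using Pi_mem[OF mem] assms(3) by blast
    show "?x i \<in> carrier M" using Pi_mem[OF mem, of i] assms(3)[of i] by blast
  qed
  also have "(\<Oplus>\<^bsub>M\<^esub>j\<in>I. ?x j) = (\<Oplus>\<^bsub>M\<^esub>j\<in>I. x j)"
  proof (rule M.finsum_cong'[OF refl])
    show "x \<in> I \<rightarrow> carrier M" using Pi_mem[OF x(2)] assms(3) by blast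
    show "?x j = x j" if "j \<in> I" for j using that assms(2) by auto
  qed
  finally have "z = (\<Oplus>\<^bsub>M\<^esub>j\<in>insert i I. ?x j)" by (simp only: x(3) fun_upd_same)
  then show "z \<in> sum_submodules M (insert i I) N"
    unfolding mem_sum_submodules_iff using mem by (intro exI[of _ ?x] conjI)
qed

lemma d_CS_Rickart_finite_sum_lies_above:
  assumes dCS: "d_CS_Rickart R M" and "finite I"
    and "\<And>i. i \<in> I \<Longrightarrow> lies_above_direct_summand R M (N i)"
  shows "lies_above_direct_summand R M (sum_submodules M I N)"
  using assms(2,3)
proof (induction I rule: finite_induct)
  case empty
  have "direct_summand R M {\<zero>\<^bsub>M\<^esub>}"
    using rsubmodule_zero rsubmodule_carrier sum_absorb[OF rsubmodule_zero rsubmodule_carrier]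
    by (auto simp: direct_summand_def internal_direct_sum_def)
  moreover have "{\<zero>\<^bsub>M\<^esub>} = {\<zero>\<^bsub>M\<^esub>} <+>\<^bsub>M\<^esub> {\<zero>\<^bsub>M\<^esub>}" using sum_absorb[OF rsubmodule_zero rsubmodule_zero] by simp
  ultimately show ?case
    using small_submodule_zero lies_above_direct_summand_iff sum_submodules_empty by metis
next
  case (insert i I)
  have "N j \<subseteq> carrier M" if "j \<in> insert i I" for j
    using insert.prems[OF that] rsubmoduleD(1)
    by (auto simp: lies_above_direct_summand_def lies_above_def)
  then have "sum_submodules M (insert i I) N = N i <+>\<^bsub>M\<^esub> sum_submodules M I N"
    using insert.hyps by (intro sum_submodules_insert)
  then show ?case
    using d_CS_Rickart_sum_lies_above[OF dCS] insert.prems insert.IH by simp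
qed

end

theorem proposition2p12:
  fixes R :: "('a, 'c) ring_scheme" and M :: "('a, 'b, 'd) rmodule_scheme"
    and S :: "('b \<Rightarrow> 'b) ring"
  assumes "right_module R M"
    and "d_CS_Rickart R M"
    and "S = End_ring R M"
  shows
    "(\<forall>A B. \<forall>e\<in>carrier S. \<forall>f\<in>carrier S.
        e \<otimes>\<^bsub>S\<^esub> e = e \<longrightarrow> f \<otimes>\<^bsub>S\<^esub> f = f \<longrightarrow> A = e ` carrier M \<longrightarrow> B = f ` carrier M \<longrightarrow>
        (\<exists>g\<in>carrier S. g \<otimes>\<^bsub>S\<^esub> g = g \<and> lies_above R M (A <+>\<^bsub>M\<^esub> B) (g ` carrier M)))
     \<and>
     (\<forall>A B. rsubmodule R M A \<longrightarrow> rsubmodule R M B \<longrightarrow>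
        (\<forall>e\<in>carrier S. \<forall>f\<in>carrier S.
          e \<otimes>\<^bsub>S\<^esub> e = e \<longrightarrow> f \<otimes>\<^bsub>S\<^esub> f = f \<longrightarrow>
          lies_above R M A (e ` carrier M) \<longrightarrow> lies_above R M B (f ` carrier M) \<longrightarrow>
          (\<exists>g\<in>carrier S. g \<otimes>\<^bsub>S\<^esub> g = g \<and> lies_above R M (A <+>\<^bsub>M\<^esub> B) (g ` carrier M))))
     \<and>
     (\<forall>(n::nat) \<phi>. \<phi> \<in> {1..n} \<rightarrow> carrier S \<longrightarrow>
        (\<exists>e\<in>carrier S. e \<otimes>\<^bsub>S\<^esub> e = e \<and>
          lies_above R M (sum_submodules M {1..n} (\<lambda>i. \<phi> i ` carrier M)) (e ` carrier M)))
     \<and>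
     SSP_d_CS R M"
proof -
  interpret right_module R M by (rule assms(1))
  note dCS = assms(2)
  note idem = lies_above_direct_summand_iff_idempotent[folded assms(3)]
  have summand: "direct_summand R M (e ` carrier M)" if "e \<in> carrier S" "e \<otimes>\<^bsub>S\<^esub> e = e" for e
    using idempotent_image_direct_summand that by (simp add: assms(3))
  have "lies_above_direct_summand R M (sum_submodules M {1..n} (\<lambda>i. \<phi> i ` carrier M))"
    if "\<phi> \<in> {1..n} \<rightarrow> carrier S" for n :: nat and \<phi>
    using that dCS
    by (intro d_CS_Rickart_finite_sum_lies_above) (auto simp: d_CS_Rickart_def assms(3))
  moreover have "SSP_d_CS R M"
    using d_CS_Rickart_sum_of_direct_summands[OF dCS] by (simp add: SSP_d_CS_def)
  moreover have "lies_above_direct_summand R M (A <+>\<^bsub>M\<^esub> B)"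
    if "e \<in> carrier S" "f \<in> carrier S" "e \<otimes>\<^bsub>S\<^esub> e = e" "f \<otimes>\<^bsub>S\<^esub> f = f"
      "lies_above R M A (e ` carrier M)" "lies_above R M B (f ` carrier M)" for A B e f
    using that idem by (intro d_CS_Rickart_sum_lies_above[OF dCS]) blast+
  moreover have "lies_above_direct_summand R M (e ` carrier M <+>\<^bsub>M\<^esub> f ` carrier M)"
    if "e \<in> carrier S" "f \<in> carrier S" "e \<otimes>\<^bsub>S\<^esub> e = e" "f \<otimes>\<^bsub>S\<^esub> f = f" for e f
    using that by (intro d_CS_Rickart_sum_of_direct_summands[OF dCS] summand)
  ultimately show ?thesis unfolding idem by simp
qed

end
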